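(* For $N\ge0$ and $\mu\in\{0,1,2\}$ let $$S_\mu(s,t,u,v,x,y)=\sum_{\pi\in\mathcal{DS}^3_{3N+\mu,\infty}}x^{|\pi_o|}y^{|\pi_e|}s^{o_1(\pi)}t^{o_2(\pi)}u^{e_1(\pi)}v^{e_2(\pi)}.$$ Then for $\mu\in\{0,2\}$, $$S_\mu=\Big(1+\tfrac{\mu}{2}(sx+tx^2)\Big)\sum_{\substack{(i,j,k,l)\in\mathbb{N}^4\\ i+j+k+l=N}}\begin{bmatrix}N\\ i,j,k,l\end{bmatrix}_{x^3y^3}(sx+tx^2)^i(ux^3y+vx^3y^2)^jx^{3k}(x^3y^3)^{\binom{i+\mu/2}{2}+\binom{j}{2}},$$ and $$S_1(s,t,u,v,x,y)=S_0(s,t,u,v,x,y)+sx^{3N+1}S_0(u,v,s,t,y,x).$$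
   Context: $\mathcal{DS}^3_{M,\infty}$ is the set of partitions into distinct parts with largest part $\le M$ in which for no $l\ge0$ are both $3l+1$ and $3l+2$ parts. For $\pi=(\pi_1>\pi_2>\cdots)$, $|\pi_o|$ (resp. $|\pi_e|$) is the sum of odd-indexed parts $\pi_1,\pi_3,\dots$ (resp. even-indexed parts $\pi_2,\pi_4,\dots$); for $i=1,2$, $o_i(\pi)$ (resp. $e_i(\pi)$) is the number of odd-indexed (resp. even-indexed) parts $\equiv i\pmod3$. The $q$-multinomial coefficient is $\begin{bmatrix}N\\ n_1,\dots,n_m\end{bmatrix}_q=\frac{(q;q)_N}{(q;q)_{n_1}\cdots(q;q)_{n_m}}$ for $n_1+\dots+n_m=N$, with $(q;q)_n=\prod_{i=1}^n(1-q^i)$. *)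

theory Defs
  imports "HOL-Computational_Algebra.Polynomial"
begin

text \<open>A partition \<open>\<pi>\<^sub>1 > \<pi>\<^sub>2 > \<dots>\<close> into distinct parts is the strictly decreasing list \<open>p\<close> of its
  positive parts, so \<open>\<pi>\<^sub>k = p ! (k - 1)\<close>: odd-indexed parts sit at \<^emph>\<open>even\<close> list positions.\<close>

definition DS3 :: "nat \<Rightarrow> nat list set" where
  "DS3 M = {p. sorted_wrt (>) p \<and> set p \<subseteq> {1..M} \<and>
               \<not> (\<exists>l. 3 * l + 1 \<in> set p \<and> 3 * l + 2 \<in> set p)}"

definition odd_sum :: "nat list \<Rightarrow> nat" where
  "odd_sum p = (\<Sum>k | k < length p \<and> even k. p ! k)"

definition even_sum :: "nat list \<Rightarrow> nat" where
  "even_sum p = (\<Sum>k | k < length p \<and> odd k. p ! k)"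

definition odd_count :: "nat \<Rightarrow> nat list \<Rightarrow> nat" where
  "odd_count i p = card {k. k < length p \<and> even k \<and> p ! k mod 3 = i}"

definition even_count :: "nat \<Rightarrow> nat list \<Rightarrow> nat" where
  "even_count i p = card {k. k < length p \<and> odd k \<and> p ! k mod 3 = i}"

definition S :: "nat \<Rightarrow> nat \<Rightarrow> 'a \<Rightarrow> 'a \<Rightarrow> 'a \<Rightarrow> 'a \<Rightarrow> 'a \<Rightarrow> 'a \<Rightarrow> 'a::comm_ring_1" where
  "S N \<mu> s t u v x y = (\<Sum>p\<in>DS3 (3 * N + \<mu>).
     x ^ odd_sum p * y ^ even_sum p *
     s ^ odd_count 1 p * t ^ odd_count 2 p * u ^ even_count 1 p * v ^ even_count 2 p)"

lemma finite_DS3: "finite (DS3 M)"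
proof (rule finite_subset)
  have "distinct p" if "sorted_wrt (>) p" for p :: "nat list"
    using that by (induction p) auto
  then show "DS3 M \<subseteq> {p. set p \<subseteq> {1..M} \<and> distinct p}"
    unfolding DS3_def by blast
qed (simp add: finite_subset_distinct)

definition qpoch :: "'a::comm_ring_1 \<Rightarrow> nat \<Rightarrow> 'a" where
  "qpoch q n = (\<Prod>i=1..n. 1 - q ^ i)"

text \<open>The \<open>q\<close>-multinomial coefficient (for \<open>sum_list ns = N\<close>) as a polynomial in the
  indeterminate \<open>q = [:0, 1:]\<close>. The division in \<open>\<int>[q]\<close> is exact, see \<open>qmultinomial_mult\<close> below.\<close>

definition qmultinomial_poly :: "nat \<Rightarrow> nat list \<Rightarrow> int poly" where
  "qmultinomial_poly N ns = qpoch [:0, 1:] N div (\<Prod>n\<leftarrow>ns. qpoch [:0, 1:] n)"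

text \<open>Its value at an element of an arbitrary commutative ring; going through the polynomial
  also gives the correct value where some \<open>1 - q ^ i\<close> vanishes or is not invertible.\<close>

definition qmultinomial :: "nat \<Rightarrow> nat list \<Rightarrow> 'a::comm_ring_1 \<Rightarrow> 'a" where
  "qmultinomial N ns q = poly (map_poly of_int (qmultinomial_poly N ns)) q"

lemma qpoch_0 [simp]: "qpoch q 0 = 1"
  by (simp add: qpoch_def)

lemma qpoch_Suc: "qpoch q (Suc n) = qpoch q n * (1 - q ^ Suc n)"
  by (simp add: qpoch_def)

lemma qpoch_mult_dvd: "qpoch q a * qpoch q b dvd qpoch q (a + b)"
proof (induction "a + b" arbitrary: a b)
  case 0
  then show ?case by simp
next
  case (Suc n)
  show ?case
  proof (cases "a = 0 \<or> b = 0")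
    case True
    then show ?thesis by auto
  next
    case False
    then obtain c d where cd: "a = Suc c" "b = Suc d"
      by (metis not0_implies_Suc)
    from Suc(2) cd have n: "n = c + b" "n = a + d" by auto
    have "qpoch q c * qpoch q b dvd qpoch q n" "qpoch q a * qpoch q d dvd qpoch q n"
      using Suc(1)[OF n(1)] Suc(1)[OF n(2)] n by auto
    then have "qpoch q c * qpoch q b * (1 - q ^ a) dvd qpoch q n * (1 - q ^ a)"
      and "qpoch q a * qpoch q d * (1 - q ^ b) dvd qpoch q n * (1 - q ^ b)"
      by (simp_all add: mult_dvd_mono)
    then have "qpoch q a * qpoch q b dvd qpoch q n * (1 - q ^ a)"
      and "qpoch q a * qpoch q b dvd qpoch q n * (1 - q ^ b)"
      by (simp_all add: cd qpoch_Suc ac_simps)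
    then have "qpoch q a * qpoch q b dvd
        qpoch q n * (1 - q ^ a) + q ^ a * (qpoch q n * (1 - q ^ b))"
      by (intro dvd_add dvd_mult[of _ "_ * _"])
    also have "\<dots> = qpoch q n * (1 - q ^ (a + b))"
      by (simp add: algebra_simps power_add)
    also have "\<dots> = qpoch q (a + b)"
      using Suc(2) qpoch_Suc[of q n] by simp
    finally show ?thesis .
  qed
qed

lemma prod_qpoch_dvd: "(\<Prod>n\<leftarrow>ns. qpoch q n) dvd qpoch q (sum_list ns)"
proof (induction ns)
  case (Cons n ns)
  then have "qpoch q n * (\<Prod>n\<leftarrow>ns. qpoch q n) dvd qpoch q n * qpoch q (sum_list ns)"
    by (simp add: mult_dvd_mono)
  also have "\<dots> dvd qpoch q (n + sum_list ns)"
    by (rule qpoch_mult_dvd)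
  finally show ?case by simp
qed simp

lemma qmultinomial_mult:
  assumes "sum_list ns = N"
  shows "qmultinomial_poly N ns * (\<Prod>n\<leftarrow>ns. qpoch [:0, 1:] n) = qpoch [:0, 1:] N"
proof -
  have "poly (qpoch [:0, 1:] n) 0 = (1 :: int)" for n
    by (induction n) (simp_all add: qpoch_Suc)
  then have "qpoch [:0, 1:] n \<noteq> (0 :: int poly)" for n
    by (metis poly_0 zero_neq_one)
  then have "(\<Prod>n\<leftarrow>ns. qpoch [:0, 1:] n) \<noteq> (0 :: int poly)"
    by (induction ns) auto
  moreover obtain c :: "int poly" where "qpoch [:0, 1:] N = (\<Prod>n\<leftarrow>ns. qpoch [:0, 1:] n) * c"
    using prod_qpoch_dvd[of "[:0, 1:]" ns] assms by (auto elim: dvdE)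
  ultimately show ?thesis
    by (simp add: qmultinomial_poly_def mult.commute)
qed

end

theory Submission imports Defs begin

text \<open>Deleting the largest part of a partition exchanges odd- and even-indexed parts, that is
  \<open>(s, t, x)\<close> and \<open>(u, v, y)\<close>. Put \<open>a = s x + t x\<^sup>2\<close>, \<open>b = u y + v y\<^sup>2\<close>, \<open>X = x\<^sup>3\<close>, \<open>Y = y\<^sup>3\<close>,
  \<open>q = X Y\<close>, and write \<open>F\<^sub>M\<close> for the generating function with largest part at most \<open>M\<close> and \<open>F\<^sub>M'\<close>
  for the exchanged one. Then \<open>F\<^sub>3\<^sub>N\<^sub>+\<^sub>2 = F\<^sub>3\<^sub>N + X\<^sup>N a F\<^sub>3\<^sub>N'\<close> and
  \<open>F\<^sub>3\<^sub>N\<^sub>+\<^sub>3 = F\<^sub>3\<^sub>N\<^sub>+\<^sub>2 + X\<^sup>N\<^sup>+\<^sup>1 F\<^sub>3\<^sub>N\<^sub>+\<^sub>2'\<close>.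

  On the other side, grouping the multinomial sum by \<open>m = i + l\<close> and applying the \<open>q\<close>-binomial theorem
  to the sums over \<open>i\<close> and \<open>j\<close> turns it (for \<open>\<mu> = 0\<close>) into the \<open>q\<close>-binomial convolution of
  \<open>(-a; q)\<^sub>m\<close> and \<open>X\<^sup>n (-b; q)\<^sub>n\<close>. Exchanging \<open>(a, X)\<close> with \<open>(b, Y)\<close> and multiplying by \<open>X\<^sup>N\<close> only
  inserts a factor \<open>q\<^sup>m\<close>, and so the \<open>q\<close>-Pascal rule gives the same recurrence.\<close>

section \<open>Weights of partitions and removal of the largest part\<close>

definition weight :: "nat list \<Rightarrow> 'a \<Rightarrow> 'a \<Rightarrow> 'a \<Rightarrow> 'a \<Rightarrow> 'a \<Rightarrow> 'a \<Rightarrow> 'a::comm_ring_1" where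
  "weight p s t u v x y = x ^ odd_sum p * y ^ even_sum p *
     s ^ odd_count 1 p * t ^ odd_count 2 p * u ^ even_count 1 p * v ^ even_count 2 p"

definition DS3_sum :: "nat \<Rightarrow> 'a \<Rightarrow> 'a \<Rightarrow> 'a \<Rightarrow> 'a \<Rightarrow> 'a \<Rightarrow> 'a \<Rightarrow> 'a::comm_ring_1" where
  "DS3_sum M s t u v x y = (\<Sum>p\<in>DS3 M. weight p s t u v x y)"

lemma S_eq_DS3_sum: "S N \<mu> s t u v x y = DS3_sum (3 * N + \<mu>) s t u v x y"
  by (simp add: S_def DS3_sum_def weight_def)

text \<open>The shift by \<open>Suc\<close> flips the parity of positions. This is why prepending a
  part exchanges odd-indexed and even-indexed statistics in the lemmas below.\<close>

lemma positions_Cons: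
  "{k. k < length (n # p) \<and> P k} =
     (if P 0 then {0} else {}) \<union> Suc ` {k. k < length p \<and> P (Suc k)}"
  by (auto simp: image_iff less_Suc_eq_0_disj)

lemma odd_sum_Cons [simp]: "odd_sum (n # p) = n + even_sum p"
proof -
  have "odd_sum (n # p) = (\<Sum>k\<in>{0} \<union> Suc ` {k. k < length p \<and> odd k}. (n # p) ! k)"
    using positions_Cons[of n p even] by (simp add: odd_sum_def)
  also have "\<dots> = n + even_sum p"
    by (subst sum.union_disjoint) (auto simp: even_sum_def sum.reindex)
  finally show ?thesis .
qed

lemma even_sum_Cons [simp]: "even_sum (n # p) = odd_sum p"
  using positions_Cons[of n p odd] by (simp add: odd_sum_def even_sum_def sum.reindex)

lemma odd_count_Cons [simp]:
  "odd_count i (n # p) = (if n mod 3 = i then Suc (even_count i p) else even_count i p)"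
proof -
  have "odd_count i (n # p) = card ((if n mod 3 = i then {0} else {}) \<union>
      Suc ` {k. k < length p \<and> odd k \<and> p ! k mod 3 = i})"
    using positions_Cons[of n p "\<lambda>k. even k \<and> (n # p) ! k mod 3 = i"]
    by (simp add: odd_count_def)
  also have "\<dots> = (if n mod 3 = i then Suc (even_count i p) else even_count i p)"
    by (simp add: even_count_def card_image)
  finally show ?thesis .
qed

lemma even_count_Cons [simp]: "even_count i (n # p) = odd_count i p"
  using positions_Cons[of n p "\<lambda>k. odd k \<and> (n # p) ! k mod 3 = i"]
  by (simp add: odd_count_def even_count_def card_image)

lemma weight_Cons:
  "weight (n # p) s t u v x y =
     x ^ n * (if n mod 3 = 1 then s else if n mod 3 = 2 then t else 1) * weight p u v s t y x"
  by (simp add: weight_def power_add mult_ac)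

text \<open>If \<open>Suc M\<close> is a part, it is the head of the list. For
  \<open>Suc M = 3 * l + 2\<close> the tail must also avoid \<open>M\<close>, so its bound drops
  once more; for \<open>Suc M = 3 * l + 1\<close> the forbidden partner is larger and cannot occur
  in the tail.\<close>

lemma DS3_Suc:
  "DS3 (Suc M) = DS3 M \<union> Cons (Suc M) ` DS3 (if Suc M mod 3 = 2 then M - 1 else M)"
    (is "_ = _ \<union> Cons _ ` DS3 ?M'")
proof (intro equalityI subsetI)
  fix p assume p: "p \<in> DS3 (Suc M)"
  show "p \<in> DS3 M \<union> Cons (Suc M) ` DS3 ?M'"
  proof (cases "Suc M \<in> set p")
    case False
    with p have "p \<in> DS3 M" by (auto simp: DS3_def le_Suc_eq)
    then show ?thesis ..
  next
    case True
    with p obtain r where r: "p = Suc M # r"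
      by (cases p) (force simp: DS3_def)+
    have sub: "set r \<subseteq> {1..M}" using p r by (force simp: DS3_def)
    have "M \<notin> set r" if "Suc M mod 3 = 2"
    proof
      assume "M \<in> set r"
      moreover from that have "Suc M = 3 * (M div 3) + 2" "M = 3 * (M div 3) + 1" by presburger+
      ultimately show False using p unfolding r DS3_def
        by (metis (mono_tags, lifting) list.set_intros mem_Collect_eq)
    qed
    with sub have "set r \<subseteq> {1..?M'}"
      by (auto simp: subset_iff) (metis One_nat_def Suc_pred le_SucE le_trans less_eq_Suc_le)+
    with p have "r \<in> DS3 ?M'" by (auto simp: r DS3_def)
    then show ?thesis by (simp add: r)
  qed
next
  fix p assume "p \<in> DS3 M \<union> Cons (Suc M) ` DS3 ?M'"
  then show "p \<in> DS3 (Suc M)"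
  proof
    assume "p \<in> DS3 M"
    then show ?thesis by (auto simp: DS3_def)
  next
    assume "p \<in> Cons (Suc M) ` DS3 ?M'"
    then obtain r where r: "p = Suc M # r" "r \<in> DS3 ?M'" by auto
    then have sub: "set r \<subseteq> {1..?M'}" by (simp add: DS3_def)
    then have sub': "set r \<subseteq> {1..M}" by (fastforce split: if_splits)
    have "\<not> (3 * l + 1 \<in> set p \<and> 3 * l + 2 \<in> set p)" for l
    proof
      assume l: "3 * l + 1 \<in> set p \<and> 3 * l + 2 \<in> set p"
      have "\<not> (3 * l + 1 \<in> set r \<and> 3 * l + 2 \<in> set r)" using r(2) by (auto simp: DS3_def)
      with l r(1) consider "Suc M = 3 * l + 2" "3 * l + 1 \<in> set r"
        | "Suc M = 3 * l + 1" "3 * l + 2 \<in> set r" by auto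
      then show False
      proof cases
        case 1
        then have "Suc M mod 3 = 2" by presburger
        then have "3 * l + 1 \<le> M - 1" "M = 3 * l + 1" using 1 sub by auto
        then show False by simp
      next
        case 2
        then show False using sub' by force
      qed
    qed
    with r sub' show ?thesis by (fastforce simp: DS3_def)
  qed
qed

lemma DS3_sum_Suc:
  "DS3_sum (Suc M) s t u v x y = DS3_sum M s t u v x y +
     x ^ Suc M * (if Suc M mod 3 = 1 then s else if Suc M mod 3 = 2 then t else 1) *
       DS3_sum (if Suc M mod 3 = 2 then M - 1 else M) u v s t y x"
proof -
  let ?M' = "if Suc M mod 3 = 2 then M - 1 else M"
  have "DS3_sum (Suc M) s t u v x y =
      DS3_sum M s t u v x y + (\<Sum>p\<in>Cons (Suc M) ` DS3 ?M'. weight p s t u v x y)"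
    unfolding DS3_sum_def DS3_Suc
    by (rule sum.union_disjoint) (simp_all add: finite_DS3, auto simp: DS3_def)
  also have "(\<Sum>p\<in>Cons (Suc M) ` DS3 ?M'. weight p s t u v x y) =
      (\<Sum>p\<in>DS3 ?M'. weight (Suc M # p) s t u v x y)"
    by (simp add: sum.reindex)
  also have "\<dots> = x ^ Suc M * (if Suc M mod 3 = 1 then s else if Suc M mod 3 = 2 then t else 1) *
       DS3_sum ?M' u v s t y x"
    unfolding weight_Cons DS3_sum_def sum_distrib_left ..
  finally show ?thesis .
qed

lemma DS3_sum_0: "DS3_sum 0 s t u v x y = 1"
proof -
  have "DS3 0 = {[]}" by (auto simp: DS3_def)
  then show ?thesis
    by (simp add: DS3_sum_def weight_def odd_sum_def even_sum_def odd_count_def even_count_def)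
qed

lemma DS3_sum_1:
  "DS3_sum (3 * N + 1) s t u v x y =
     DS3_sum (3 * N) s t u v x y + s * x ^ (3 * N + 1) * DS3_sum (3 * N) u v s t y x"
proof -
  have "Suc (3 * N) mod 3 = 1" by presburger
  then show ?thesis using DS3_sum_Suc[of "3 * N" s t u v x y] by (simp add: mult_ac)
qed

text \<open>The parts \<open>3 * N + 1\<close> and \<open>3 * N + 2\<close> exclude each other, so
  after either of them the tail ranges over the same set \<open>DS3 (3 * N)\<close> and the two
  weights add up.\<close>

lemma DS3_sum_2:
  "DS3_sum (3 * N + 2) s t u v x y = DS3_sum (3 * N) s t u v x y +
     (x ^ 3) ^ N * (s * x + t * x ^ 2) * DS3_sum (3 * N) u v s t y x"
proof -
  have "Suc (3 * N + 1) mod 3 = 2" by presburger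
  then have "DS3_sum (3 * N + 2) s t u v x y =
      DS3_sum (3 * N + 1) s t u v x y + x ^ (3 * N + 2) * t * DS3_sum (3 * N) u v s t y x"
    using DS3_sum_Suc[of "3 * N + 1" s t u v x y] by simp
  then show ?thesis
    unfolding DS3_sum_1 by (simp add: algebra_simps power2_eq_square flip: power_mult)
qed

lemma DS3_sum_3:
  "DS3_sum (3 * Suc N) s t u v x y = DS3_sum (3 * N + 2) s t u v x y +
     (x ^ 3) ^ Suc N * DS3_sum (3 * N + 2) u v s t y x"
proof -
  have "Suc (3 * N + 2) = 3 * Suc N" "Suc (3 * N + 2) mod 3 = 0" by presburger+
  moreover from this(1) have "x ^ Suc (3 * N + 2) = (x ^ 3) ^ Suc N"
    by (simp only: power_mult)
  ultimately show ?thesis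
    using DS3_sum_Suc[of "3 * N + 2" s t u v x y] by (simp only: if_False mult_1_right) simp
qed

section \<open>q-binomial and q-multinomial coefficients\<close>

text \<open>Defining the \<open>q\<close>-binomial coefficient by the Pascal rule makes sense over every commutative
  ring; the identification with quotients of \<open>q\<close>-factorials is done in \<open>\<int>[q]\<close>, where one can cancel.\<close>

fun qbinomial :: "'a::comm_ring_1 \<Rightarrow> nat \<Rightarrow> nat \<Rightarrow> 'a" where
  "qbinomial q n 0 = 1"
| "qbinomial q 0 (Suc k) = 0"
| "qbinomial q (Suc n) (Suc k) = qbinomial q n k + q ^ Suc k * qbinomial q n (Suc k)"

lemma qbinomial_eq_0: "n < k \<Longrightarrow> qbinomial q n k = 0"
  by (induction q n k rule: qbinomial.induct) auto

lemma qbinomial_mult_qpoch: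
  "qbinomial q (a + b) a * qpoch q a * qpoch q b = qpoch q (a + b)"
proof (induction "a + b" arbitrary: a b)
  case 0
  then show ?case by simp
next
  case (Suc n)
  consider "a = 0" | c where "a = Suc c" "b = 0" | c d where "a = Suc c" "b = Suc d"
    by (metis not0_implies_Suc)
  then show ?case
  proof cases
    case 1
    then show ?thesis by simp
  next
    case 2
    with Suc(1)[of c 0] Suc(2) show ?thesis
      by (simp add: qbinomial_eq_0 qpoch_Suc flip: mult.assoc)
  next
    case 3
    with Suc(2) have n: "n = c + Suc d" "n = Suc c + d" by auto
    have "qbinomial q (a + b) a * qpoch q a * qpoch q b =
        (qbinomial q n c * qpoch q c * qpoch q (Suc d)) * (1 - q ^ Suc c) +
        (qbinomial q n (Suc c) * qpoch q (Suc c) * qpoch q d) * (q ^ Suc c * (1 - q ^ Suc d))"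
      using 3 n by (simp add: qpoch_Suc algebra_simps)
    \<comment> \<open>Since \<open>Suc n = Suc c + Suc d\<close>, the factor in parentheses
      collapses to \<open>1 - q ^ Suc n\<close>.\<close>
    also have "\<dots> = qpoch q n * (1 - q ^ Suc c + q ^ Suc c * (1 - q ^ Suc d))"
      using Suc(1)[OF n(1)] Suc(1)[OF n(2)] n by (simp add: distrib_left)
    also have "\<dots> = qpoch q (Suc n)"
      using n by (simp add: qpoch_Suc algebra_simps power_add)
    finally show ?thesis using Suc(2) by simp
  qed
qed


lemma qpoch_poly_nonzero: "qpoch [:0, 1:] n \<noteq> (0 :: int poly)"
proof -
  have "poly (qpoch [:0, 1:] n) 0 = (1 :: int)"
    by (induction n) (simp_all add: qpoch_Suc)
  then show ?thesis by (metis poly_0 zero_neq_one)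
qed

text \<open>This and the next lemmas make evaluation at \<open>q\<close> a ring homomorphism on
  integer polynomials, which transports identities proved by cancellation to any commutative
  ring.\<close>

lemma poly_of_int_add:
  "poly (map_poly of_int (p + r)) (q :: 'a::comm_ring_1) =
     poly (map_poly of_int p) q + poly (map_poly of_int r) q"
proof -
  have "map_poly of_int (p + r) = (map_poly of_int p + map_poly of_int r :: 'a poly)"
    by (rule poly_eqI) (simp add: coeff_map_poly)
  then show ?thesis by simp
qed

lemma poly_of_int_mult:
  "poly (map_poly of_int (p * r)) (q :: 'a::comm_ring_1) =
     poly (map_poly of_int p) q * poly (map_poly of_int r) q"
proof (induction p)
  case (pCons a p)
  have "map_poly of_int (smult a r) = smult (of_int a) (map_poly of_int r :: 'a poly)"
    by (rule poly_eqI) (simp add: coeff_map_poly)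
  with pCons show ?case
    by (simp add: poly_of_int_add map_poly_pCons algebra_simps)
qed simp

lemma poly_of_int_power_var:
  "poly (map_poly of_int ([:0, 1:] ^ n)) (q :: 'a::comm_ring_1) = q ^ n"
  by (induction n) (simp_all add: poly_of_int_mult map_poly_pCons del: mult_pCons_left)

lemma poly_of_int_qbinomial:
  "poly (map_poly of_int (qbinomial [:0, 1:] n k)) q = qbinomial q n k"
  by (induction q n k rule: qbinomial.induct)
    (simp_all add: poly_of_int_add poly_of_int_mult poly_of_int_power_var
      del: power_Suc mult_pCons_left)

text \<open>The Pascal recursion hides the symmetry. Over the integer polynomials both sides have
  the same product with nonzero q-factorials.\<close>

lemma qbinomial_symmetric:
  "qbinomial (q :: 'a::comm_ring_1) (a + b) a = qbinomial q (a + b) b"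
proof -
  let ?b = "qbinomial [:0, 1 :: int:]" and ?P = "qpoch [:0, 1 :: int:]"
  have "?b (a + b) a * (?P a * ?P b) = ?b (a + b) b * (?P a * ?P b)"
    using qbinomial_mult_qpoch[of "[:0, 1 :: int:]" a b] qbinomial_mult_qpoch[of "[:0, 1 :: int:]" b a]
    by (simp only: mult.assoc add.commute[of b a] mult.commute[of "?P b" "?P a"])
  then have "?b (a + b) a = ?b (a + b) b"
    by (simp only: mult_right_cancel mult_eq_0_iff qpoch_poly_nonzero simp_thms)
  then show ?thesis by (metis poly_of_int_qbinomial)
qed

text \<open>The pairing of \<open>i\<close> with \<open>l\<close> and of \<open>j\<close> with
  \<open>k\<close> anticipates the grouping of the multinomial sum; all q-factorials of the
  intermediate sizes cancel.\<close>

lemma qmultinomial_eq_qbinomial: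
  "qmultinomial (i + j + k + l) [i, j, k, l] q =
     qbinomial q ((i + l) + (j + k)) (i + l) * qbinomial q (i + l) i * qbinomial q (j + k) j"
proof -
  let ?b = "qbinomial [:0, 1 :: int:]" and ?P = "qpoch [:0, 1 :: int:]"
  let ?B = "?b ((i + l) + (j + k)) (i + l) * ?b (i + l) i * ?b (j + k) j"
  have "?B * (?P i * ?P j * ?P k * ?P l) = ?b ((i + l) + (j + k)) (i + l) *
      (?b (i + l) i * ?P i * ?P l) * (?b (j + k) j * ?P j * ?P k)"
    by (simp add: ac_simps)
  also have "\<dots> = ?P (i + j + k + l)"
    by (simp only: qbinomial_mult_qpoch) (simp add: ac_simps)
  also have "\<dots> = qmultinomial_poly (i + j + k + l) [i, j, k, l] * (?P i * ?P j * ?P k * ?P l)"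
    by (subst qmultinomial_mult[symmetric, of "[i, j, k, l]"]) (simp_all add: ac_simps)
  finally have "qmultinomial_poly (i + j + k + l) [i, j, k, l] = ?B"
    by (simp add: qpoch_poly_nonzero)
  then show ?thesis
    by (simp add: qmultinomial_def poly_of_int_mult poly_of_int_qbinomial)
qed

text \<open>The Pascal rule in summed form, for arbitrary \<open>g\<close>; it drives the inductions
  for both the q-binomial theorem and the convolution.\<close>

lemma sum_qbinomial_Suc:
  "(\<Sum>k\<le>Suc n. qbinomial q (Suc n) k * g k) =
     (\<Sum>k\<le>n. qbinomial q n k * (g (Suc k) + q ^ k * g k))"
proof -
  \<comment> \<open>The added term \<open>k = Suc n\<close> vanishes; with it the sum can be shifted
    after splitting off \<open>k = 0\<close>.\<close>
  have "(\<Sum>k\<le>n. qbinomial q n k * (q ^ k * g k)) = (\<Sum>k\<le>Suc n. qbinomial q n k * (q ^ k * g k))"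
    by (simp add: qbinomial_eq_0)
  also have "\<dots> = g 0 + (\<Sum>k\<le>n. qbinomial q n (Suc k) * (q ^ Suc k * g (Suc k)))"
    by (subst sum.atMost_Suc_shift) simp
  finally show ?thesis
    by (subst sum.atMost_Suc_shift) (simp add: distrib_left distrib_right sum.distrib ac_simps)
qed

section \<open>Rising q-factorials and their convolution\<close>

text \<open>\<open>qrising q a n\<close> is \<open>(-a; q)\<^sub>n\<close>.\<close>

definition qrising :: "'a::comm_ring_1 \<Rightarrow> 'a \<Rightarrow> nat \<Rightarrow> 'a" where
  "qrising q a n = (\<Prod>i<n. 1 + a * q ^ i)"

lemma qrising_0 [simp]: "qrising q a 0 = 1"
  by (simp add: qrising_def)

lemma qrising_Suc: "qrising q a (Suc n) = (1 + a * q ^ n) * qrising q a n"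
  by (simp add: qrising_def mult.commute)

lemma qrising_Suc_shift: "qrising q a (Suc n) = (1 + a) * qrising q (a * q) n"
  unfolding qrising_def by (subst prod.lessThan_Suc_shift) (simp add: mult.assoc)

lemma choose_2_Suc: "Suc k choose 2 = k + (k choose 2)"
  by (simp add: numeral_2_eq_2)

lemma qbinomial_theorem:
  "(\<Sum>k\<le>n. qbinomial q n k * (a ^ k * q ^ (k choose 2))) = qrising q a n"
proof (induction n arbitrary: a)
  case (Suc n)
  have "(\<Sum>k\<le>Suc n. qbinomial q (Suc n) k * (a ^ k * q ^ (k choose 2))) =
      (1 + a) * (\<Sum>k\<le>n. qbinomial q n k * ((a * q) ^ k * q ^ (k choose 2)))"
    unfolding sum_qbinomial_Suc sum_distrib_left
    by (rule sum.cong) (simp_all add: choose_2_Suc power_add power_mult_distrib algebra_simps)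
  then show ?case by (simp add: Suc.IH qrising_Suc_shift)
qed (simp add: numeral_2_eq_2)

definition qrising_conv :: "'a::comm_ring_1 \<Rightarrow> 'a \<Rightarrow> 'a \<Rightarrow> 'a \<Rightarrow> nat \<Rightarrow> 'a" where
  "qrising_conv a b X Y n = (\<Sum>k\<le>n. qbinomial (X * Y) n k *
     (qrising (X * Y) a k * (X ^ (n - k) * qrising (X * Y) b (n - k))))"

text \<open>Reverse the summation by \<open>k\<close> to \<open>n - k\<close>, use the symmetry of
  the q-binomial, and write \<open>X ^ n * Y ^ k\<close> as
  \<open>(X * Y) ^ k * X ^ (n - k)\<close>.\<close>

lemma qrising_conv_swap:
  "X ^ n * qrising_conv b a Y X n = (\<Sum>k\<le>n. qbinomial (X * Y) n k *
     ((X * Y) ^ k * qrising (X * Y) a k * (X ^ (n - k) * qrising (X * Y) b (n - k))))"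
proof -
  let ?q = "X * Y"
  have "X ^ n * qrising_conv b a Y X n = (\<Sum>k\<le>n. X ^ n * (qbinomial ?q n k *
      (qrising ?q b k * (Y ^ (n - k) * qrising ?q a (n - k)))))"
    by (simp add: qrising_conv_def sum_distrib_left mult.commute[of Y X])
  also have "\<dots> = (\<Sum>k\<le>n. X ^ n * (qbinomial ?q n (n - k) *
      (qrising ?q b (n - k) * (Y ^ k * qrising ?q a k))))"
    by (rule sum.reindex_bij_witness[of _ "\<lambda>k. n - k" "\<lambda>k. n - k"]) auto
  also have "\<dots> = (\<Sum>k\<le>n. qbinomial ?q n k *
     (?q ^ k * qrising ?q a k * (X ^ (n - k) * qrising ?q b (n - k))))"
  proof (rule sum.cong)
    fix k assume "k \<in> {..n}"
    then obtain m where n: "n = k + m" by (auto simp: le_iff_add)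
    show "X ^ n * (qbinomial ?q n (n - k) * (qrising ?q b (n - k) * (Y ^ k * qrising ?q a k))) =
        qbinomial ?q n k * (?q ^ k * qrising ?q a k * (X ^ (n - k) * qrising ?q b (n - k)))"
      unfolding n using qbinomial_symmetric[of ?q k m]
      by (simp add: power_add power_mult_distrib ac_simps)
  qed simp
  finally show ?thesis .
qed

text \<open>With \<open>q = X * Y\<close>, the Pascal rule multiplies the \<open>k\<close>-th term
  by \<open>(1 + a * q ^ k) + q ^ k * X * (1 + b * q ^ (n - k))\<close>. The part free of
  \<open>k\<close> is \<open>1 + X * b * q ^ n\<close>; the rest is \<open>(a + X) * q ^ k\<close>,
  which yields the swapped convolution.\<close>

lemma qrising_conv_Suc:
  "qrising_conv a b X Y (Suc n) = (1 + X ^ Suc n * Y ^ n * b) * qrising_conv a b X Y n +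
     X ^ n * (a + X) * qrising_conv b a Y X n"
proof -
  let ?q = "X * Y"
  have "qrising_conv a b X Y (Suc n) = (\<Sum>k\<le>n. qbinomial ?q n k *
      (qrising ?q a (Suc k) * (X ^ (n - k) * qrising ?q b (n - k)) +
       ?q ^ k * (qrising ?q a k * (X ^ (Suc n - k) * qrising ?q b (Suc n - k)))))"
    unfolding qrising_conv_def sum_qbinomial_Suc by simp
  also have "\<dots> = (\<Sum>k\<le>n. (1 + X ^ Suc n * Y ^ n * b) *
        (qbinomial ?q n k * (qrising ?q a k * (X ^ (n - k) * qrising ?q b (n - k)))) +
      (a + X) * (qbinomial ?q n k *
        (?q ^ k * qrising ?q a k * (X ^ (n - k) * qrising ?q b (n - k)))))"
  proof (rule sum.cong)
    fix k assume "k \<in> {..n}"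
    then obtain m where n: "n = k + m" by (auto simp: le_iff_add)
    show "qbinomial ?q n k *
      (qrising ?q a (Suc k) * (X ^ (n - k) * qrising ?q b (n - k)) +
       ?q ^ k * (qrising ?q a k * (X ^ (Suc n - k) * qrising ?q b (Suc n - k)))) =
      (1 + X ^ Suc n * Y ^ n * b) *
        (qbinomial ?q n k * (qrising ?q a k * (X ^ (n - k) * qrising ?q b (n - k)))) +
      (a + X) * (qbinomial ?q n k *
        (?q ^ k * qrising ?q a k * (X ^ (n - k) * qrising ?q b (n - k))))"
      unfolding n
      by (simp add: qrising_Suc Suc_diff_le power_add power_mult_distrib algebra_simps)
  qed simp
  also have "\<dots> = (1 + X ^ Suc n * Y ^ n * b) * qrising_conv a b X Y n +
      (a + X) * (X ^ n * qrising_conv b a Y X n)"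
    unfolding sum.distrib sum_distrib_left[symmetric] qrising_conv_swap[symmetric]
    by (simp only: qrising_conv_def)
  finally show ?thesis by (simp add: ac_simps)
qed

text \<open>Termwise, \<open>1 + a * q ^ k\<close> extends the rising factorial at its end; taking
  \<open>1 + a\<close> off at its start leaves the parameter \<open>a * q\<close>.\<close>

lemma qrising_conv_add_swap:
  "qrising_conv a b X Y n + X ^ n * a * qrising_conv b a Y X n =
     (1 + a) * qrising_conv (a * (X * Y)) b X Y n"
proof -
  let ?q = "X * Y"
  have rising: "qrising ?q a k + a * (?q ^ k * qrising ?q a k) = (1 + a) * qrising ?q (a * ?q) k"
    for k unfolding qrising_Suc_shift[symmetric] by (simp add: qrising_Suc algebra_simps)
  have "qrising_conv a b X Y n + a * (X ^ n * qrising_conv b a Y X n) =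
      (\<Sum>k\<le>n. qbinomial ?q n k * ((qrising ?q a k + a * (?q ^ k * qrising ?q a k)) *
         (X ^ (n - k) * qrising ?q b (n - k))))"
    unfolding qrising_conv_swap
    by (simp add: qrising_conv_def sum_distrib_left sum.distrib algebra_simps)
  also have "\<dots> = (1 + a) * qrising_conv (a * ?q) b X Y n"
    unfolding rising by (simp add: qrising_conv_def sum_distrib_left mult_ac)
  finally show ?thesis by (simp add: ac_simps)
qed

section \<open>Both sides as convolutions\<close>

lemma DS3_sum_eq_qrising_conv:
  "DS3_sum (3 * n) s t u v x y =
     qrising_conv (s * x + t * x ^ 2) (u * y + v * y ^ 2) (x ^ 3) (y ^ 3) n"
proof (induction n arbitrary: s t u v x y)
  case 0
  then show ?case by (simp add: DS3_sum_0 qrising_conv_def)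
next
  case (Suc n)
  show ?case
    unfolding DS3_sum_3 DS3_sum_2 Suc.IH qrising_conv_Suc by (simp add: algebra_simps)
qed

text \<open>No weight depends on \<open>l\<close>, so for fixed \<open>m = i + l\<close> the sums
  over \<open>i\<close> and over \<open>j, k\<close> separate.\<close>

lemma sum_qmultinomial_4:
  "(\<Sum>(i, j, k, l) \<in> {(i, j, k, l). i + j + k + l = N}. qmultinomial N [i, j, k, l] q * (f i * g j k)) =
     (\<Sum>m\<le>N. qbinomial q N m * ((\<Sum>i\<le>m. qbinomial q m i * f i) *
        (\<Sum>j\<le>N - m. qbinomial q (N - m) j * g j (N - m - j))))"
proof -
  have "(\<Sum>m\<le>N. qbinomial q N m * ((\<Sum>i\<le>m. qbinomial q m i * f i) *
        (\<Sum>j\<le>N - m. qbinomial q (N - m) j * g j (N - m - j)))) =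
      (\<Sum>(m, i, j) \<in> (SIGMA m:{..N}. {..m} \<times> {..N - m}). qbinomial q N m *
        ((qbinomial q m i * f i) * (qbinomial q (N - m) j * g j (N - m - j))))"
    unfolding sum_product
    unfolding sum.cartesian_product sum_distrib_left
    by (subst sum.Sigma) (simp_all add: split_def)
  also have "\<dots> = (\<Sum>(i, j, k, l) \<in> {(i, j, k, l). i + j + k + l = N}.
      qmultinomial N [i, j, k, l] q * (f i * g j k))"
  proof (rule sum.reindex_bij_witness[of _ "\<lambda>(i, j, k, l). (i + l, i, j)"
        "\<lambda>(m, i, j). (i, j, N - m - j, m - i)"], goal_cases)
    case (5 a)
    then obtain m i j where a: "a = (m, i, j)" "m \<le> N" "i \<le> m" "j \<le> N - m" by auto
    define k l where "k = N - m - j" and "l = m - i"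
    with a have N: "m = i + l" "N - m = j + k" "N = i + j + k + l" "N = (i + l) + (j + k)" by auto
    have "qmultinomial N [i, j, k, l] q = qbinomial q N m * qbinomial q m i * qbinomial q (N - m) j"
      using qmultinomial_eq_qbinomial[of i j k l q] N by metis
    then show ?case by (simp add: a(1) k_def l_def mult_ac)
  qed auto
  finally show ?thesis ..
qed

text \<open>Only the weight of \<open>i\<close> depends on \<mu>, so \<open>f\<close> stays general.
  The powers \<open>X ^ j\<close> and \<open>X ^ (n - j)\<close> combine to the constant factor
  \<open>X ^ n\<close>.\<close>

lemma sum_qmultinomial_eq_qrising_conv:
  assumes "\<And>m. (\<Sum>i\<le>m. qbinomial (X * Y) m i * f i) = qrising (X * Y) a m"
  shows "(\<Sum>(i, j, k, l) \<in> {(i, j, k, l). i + j + k + l = N}. qmultinomial N [i, j, k, l] (X * Y) *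
       (f i * ((X * b) ^ j * X ^ k * (X * Y) ^ (j choose 2)))) = qrising_conv a b X Y N"
proof -
  have "(\<Sum>j\<le>n. qbinomial (X * Y) n j * ((X * b) ^ j * X ^ (n - j) * (X * Y) ^ (j choose 2))) =
      X ^ n * qrising (X * Y) b n" for n
    unfolding qbinomial_theorem[symmetric] sum_distrib_left
  proof (rule sum.cong)
    fix j assume "j \<in> {..n}"
    then have "X ^ n = X ^ j * X ^ (n - j)" by (simp flip: power_add)
    then show "qbinomial (X * Y) n j * ((X * b) ^ j * X ^ (n - j) * (X * Y) ^ (j choose 2)) =
        X ^ n * (qbinomial (X * Y) n j * (b ^ j * (X * Y) ^ (j choose 2)))"
      by (simp add: power_mult_distrib mult_ac)
  qed simp
  then show ?thesis
    by (simp only: sum_qmultinomial_4 assms qrising_conv_def)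
qed

theorem theorem3p9:
  fixes s t u v x y :: "'a::comm_ring_1" and N :: nat
  shows "(\<forall>\<mu>\<in>{0, 2}.
            S N \<mu> s t u v x y =
              (1 + of_nat (\<mu> div 2) * (s * x + t * x ^ 2)) *
              (\<Sum>(i, j, k, l) \<in> {(i, j, k, l). i + j + k + l = N}.
                 qmultinomial N [i, j, k, l] (x ^ 3 * y ^ 3) *
                 (s * x + t * x ^ 2) ^ i *
                 (u * x ^ 3 * y + v * x ^ 3 * y ^ 2) ^ j *
                 x ^ (3 * k) *
                 (x ^ 3 * y ^ 3) ^ (((i + \<mu> div 2) choose 2) + (j choose 2)))) \<and>
         S N 1 s t u v x y = S N 0 s t u v x y + s * x ^ (3 * N + 1) * S N 0 u v s t y x"
proof -
  let ?a = "s * x + t * x ^ 2" and ?b = "u * y + v * y ^ 2" and ?X = "x ^ 3" and ?Y = "y ^ 3"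
  let ?sum = "\<lambda>d. \<Sum>(i, j, k, l) \<in> {(i, j, k, l). i + j + k + l = N}.
      qmultinomial N [i, j, k, l] (?X * ?Y) * ?a ^ i * (u * x ^ 3 * y + v * x ^ 3 * y ^ 2) ^ j *
        x ^ (3 * k) * (?X * ?Y) ^ (((i + d) choose 2) + (j choose 2))"
  have b: "u * x ^ 3 * y + v * x ^ 3 * y ^ 2 = ?X * ?b"
    by (simp add: algebra_simps)
  have sum: "?sum d = (\<Sum>(i, j, k, l) \<in> {(i, j, k, l). i + j + k + l = N}.
      qmultinomial N [i, j, k, l] (?X * ?Y) * ((?a ^ i * (?X * ?Y) ^ ((i + d) choose 2)) *
        ((?X * ?b) ^ j * ?X ^ k * (?X * ?Y) ^ (j choose 2))))" for d
    unfolding b power_add power_mult by (simp only: mult_ac)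
  have "?sum 0 = qrising_conv ?a ?b ?X ?Y N"
    unfolding sum by (rule sum_qmultinomial_eq_qrising_conv) (simp add: qbinomial_theorem)
  then have "S N 0 s t u v x y = ?sum 0"
    by (simp add: S_eq_DS3_sum DS3_sum_eq_qrising_conv)
  moreover have "?sum 1 = qrising_conv (?a * (?X * ?Y)) ?b ?X ?Y N"
    unfolding sum
  proof (rule sum_qmultinomial_eq_qrising_conv)
    \<comment> \<open>Raising \<open>i\<close> to \<open>i + 1\<close> in the binomial exponent
      contributes an extra \<open>q ^ i\<close>, which is absorbed into
      \<open>a ^ i\<close>.\<close>
    show "(\<Sum>i\<le>m. qbinomial (?X * ?Y) m i * (?a ^ i * (?X * ?Y) ^ ((i + 1) choose 2))) =
        qrising (?X * ?Y) (?a * (?X * ?Y)) m" for m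
      unfolding qbinomial_theorem[symmetric] Suc_eq_plus1[symmetric] choose_2_Suc power_add
      by (simp only: power_mult_distrib mult_ac)
  qed
  then have "S N 2 s t u v x y = (1 + ?a) * ?sum 1"
    by (simp only: S_eq_DS3_sum DS3_sum_2 DS3_sum_eq_qrising_conv qrising_conv_add_swap)
  moreover have "S N 1 s t u v x y = S N 0 s t u v x y + s * x ^ (3 * N + 1) * S N 0 u v s t y x"
    using DS3_sum_1[of N s t u v x y] by (simp add: S_eq_DS3_sum)
  ultimately show ?thesis by simp
qed

end
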